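(* Let $\mathcal H$ be a complex Hilbert space. Every element of $M(\mathcal H)$ which is not a pure rotation, i.e. every operator $M_{\phi_{a,U}}$ with $a\in B$, $a\neq 0$, and $U$ a unitary operator on $\mathcal H$, is a smooth point of $\mathcal B(\mathcal H\oplus\mathbb C)$.
   Context: Let $B$ be the open unit ball of the complex Hilbert space $\mathcal H$ (inner product linear in the first variable). For $a\in B$ and a unitary operator $U$ on $\mathcal H$, put $\alpha(a)=\sqrt{1-\|a\|^2}$, let $P_a$ be the orthogonal projection onto $\mathbb Ca$ and $Q_a=I-P_a$ (so $P_0=0$, $Q_0=I$). The automorphism $\phi_{a,U}\in\operatorname{Aut}(B)$ is $\phi_{a,U}(z)=U\frac{(P_a+\alpha(a)Q_a)z-a}{1-\langle z,a\rangle}$. The associated bounded operator $M_{\phi_{a,U}}$ on the Hilbert space direct sum $\mathcal H\oplus\mathbb C$ is $$M_{\phi_{a,U}}(x,\lambda)=\bigl(U(P_a+\alpha(a)Q_a)x-\lambda Ua,\ -\langle x,a\rangle+\lambda\bigr).$$ $M(\mathcal H)=\{M_{\phi_{a,U}}: a\in B,\ U \text{ unitary on }\mathcal H\}\subset\mathcal B(\mathcal H\oplus\mathbb C)$. Elements $\phi_{0,U}$ of $\operatorname{Aut}(B)$, and the corresponding operators $M_{\phi_{0,U}}$, are called pure rotations. $\mathcal B(\mathcal H\oplus\mathbb C)$ is the space of bounded linear operators on $\mathcal H\oplus\mathbb C$ with the operator norm. A nonzero element $x$ of a normed space $X$ is a smooth point if the norm of $X$ is G\^ateaux differentiable at $x$,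 i.e. $\lim_{t\to 0,\,t\in\mathbb R}\frac{\|x+ty\|-\|x\|}{t}$ exists for all $y\in X$. *)

theory Defs
  imports "HOL-Analysis.Analysis"
begin

text \<open>
  Complex Hilbert spaces. As the complex scalar multiplication restricts to the real one and the
  norm is the one induced by the inner product, such a space is also a real normed space in the
  sense of the library. The inner product is linear in its first argument.
\<close>

class complex_inner = real_normed_vector +
  fixes scaleC :: "complex \<Rightarrow> 'a \<Rightarrow> 'a" (infixr "*\<^sub>C" 75)
    and cinner :: "'a \<Rightarrow> 'a \<Rightarrow> complex"
  assumes scaleC_add_right: "c *\<^sub>C (x + y) = c *\<^sub>C x + c *\<^sub>C y"
    and scaleC_add_left: "(c + d) *\<^sub>C x = c *\<^sub>C x + d *\<^sub>C x"
    and scaleC_scaleC: "c *\<^sub>C d *\<^sub>C x = (c * d) *\<^sub>C x"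
    and scaleC_one: "1 *\<^sub>C x = x"
    and scaleR_scaleC: "r *\<^sub>R x = complex_of_real r *\<^sub>C x"
    and cinner_commute: "cinner x y = cnj (cinner y x)"
    and cinner_add_left: "cinner (x + y) z = cinner x z + cinner y z"
    and cinner_scaleC_left: "cinner (c *\<^sub>C x) y = c * cinner x y"
    and cinner_ge_zero: "0 \<le> Re (cinner x x)"
    and cinner_eq_zero_iff: "cinner x x = 0 \<longleftrightarrow> x = 0"
    and norm_eq_sqrt_cinner: "norm x = sqrt (Re (cinner x x))"

class chilbert_space = complex_inner + banach

lemma cinner_add_right: "cinner x (y + z) = cinner x y + cinner (x::'a::complex_inner) z"
  by (subst (1 2 3) cinner_commute) (simp add: cinner_add_left)

lemma cinner_scaleC_right: "cinner x (c *\<^sub>C y) = cnj c * cinner (x::'a::complex_inner) y"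
  by (subst (1 2) cinner_commute) (simp add: cinner_scaleC_left)

lemma scaleC_zero_left: "0 *\<^sub>C x = (0::'a::complex_inner)"
  using scaleC_add_left[of 0 0 x] by simp

lemma scaleC_minus_left: "(- c) *\<^sub>C x = - (c *\<^sub>C (x::'a::complex_inner))"
  using scaleC_add_left[of "- c" c x] by (simp add: scaleC_zero_left eq_neg_iff_add_eq_0)

lemma cinner_minus_left: "cinner (- x) y = - cinner (x::'a::complex_inner) y"
  using cinner_scaleC_left[of "- 1" x y] by (simp add: scaleC_minus_left scaleC_one)

lemma cinner_diff_left: "cinner (x - y) z = cinner x z - cinner (y::'a::complex_inner) z"
  using cinner_add_left[of x "- y" z] by (simp add: cinner_minus_left)

lemma cinner_self: "cinner x x = complex_of_real ((norm (x::'a::complex_inner))\<^sup>2)"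
proof -
  have "Im (cinner x x) = 0"
    using arg_cong[OF cinner_commute[of x x], of Im] by simp
  then show ?thesis
    by (simp add: complex_eq_iff norm_eq_sqrt_cinner cinner_ge_zero)
qed

lemma norm_scaleC: "norm (c *\<^sub>C x) = cmod c * norm (x::'a::complex_inner)"
proof -
  have "cinner (c *\<^sub>C x) (c *\<^sub>C x) = complex_of_real ((cmod c)\<^sup>2 * (norm x)\<^sup>2)"
    unfolding cinner_scaleC_left cinner_scaleC_right cinner_self[of x]
    by (simp only: of_real_mult complex_norm_square mult.assoc mult.left_commute)
  then show ?thesis
    by (simp add: norm_eq_sqrt_cinner[of "c *\<^sub>C x"] real_sqrt_mult del: of_real_mult)
qed


text \<open>
  The library norm \<open>norm (x, y) = sqrt ((norm x)\<^sup>2 + (norm y)\<^sup>2)\<close> on products is the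
  norm of the Hilbert space direct sum.
\<close>

instantiation complex :: chilbert_space
begin

definition scaleC_complex :: "complex \<Rightarrow> complex \<Rightarrow> complex"
  where "scaleC_complex c x = c * x"

definition cinner_complex :: "complex \<Rightarrow> complex \<Rightarrow> complex"
  where "cinner_complex x y = x * cnj y"

instance
  by standard
    (auto simp: scaleC_complex_def cinner_complex_def algebra_simps scaleR_conv_of_real
      cmod_def power2_eq_square)

end

instantiation prod :: (complex_inner, complex_inner) complex_inner
begin

definition scaleC_prod :: "complex \<Rightarrow> 'a \<times> 'b \<Rightarrow> 'a \<times> 'b"
  where "scaleC_prod c p = (c *\<^sub>C fst p, c *\<^sub>C snd p)"

definition cinner_prod :: "'a \<times> 'b \<Rightarrow> 'a \<times> 'b \<Rightarrow> complex"
  where "cinner_prod p q = cinner (fst p) (fst q) + cinner (snd p) (snd q)"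

instance
proof
  fix c d :: complex and r :: real and x y z :: "'a \<times> 'b"
  show "c *\<^sub>C (x + y) = c *\<^sub>C x + c *\<^sub>C y" "(c + d) *\<^sub>C x = c *\<^sub>C x + d *\<^sub>C x"
    "c *\<^sub>C d *\<^sub>C x = (c * d) *\<^sub>C x" "1 *\<^sub>C x = x" "r *\<^sub>R x = complex_of_real r *\<^sub>C x"
    by (auto simp: scaleC_prod_def scaleC_add_right scaleC_add_left scaleC_scaleC scaleC_one
        scaleR_scaleC prod_eq_iff)
  show "cinner x y = cnj (cinner y x)"
    unfolding cinner_prod_def
    by (subst cinner_commute[of "fst x"], subst cinner_commute[of "snd x"]) simp
  show "cinner (x + y) z = cinner x z + cinner y z" "cinner (c *\<^sub>C x) y = c * cinner x y"
    by (simp_all add: cinner_prod_def scaleC_prod_def cinner_add_left cinner_scaleC_left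
        algebra_simps)
  have self: "cinner x x = complex_of_real ((norm (fst x))\<^sup>2 + (norm (snd x))\<^sup>2)"
    by (simp add: cinner_prod_def cinner_self)
  show "0 \<le> Re (cinner x x)" "norm x = sqrt (Re (cinner x x))"
    by (simp_all add: self norm_prod_def del: of_real_add of_real_power)
  show "cinner x x = 0 \<longleftrightarrow> x = 0"
    unfolding self of_real_eq_0_iff by (simp add: sum_power2_eq_zero_iff prod_eq_iff)
qed

end

instance prod :: (chilbert_space, chilbert_space) chilbert_space ..


text \<open>
  \<open>bounded_operators\<close> is the space of bounded complex-linear operators on a complex Hilbert space,
  as the subspace of complex-homogeneous elements of the library's space of bounded real-linear
  maps, whose norm is the operator norm.
\<close>

definition bounded_operators :: "('a::complex_inner \<Rightarrow>\<^sub>L 'a) set"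
  where "bounded_operators = {T. \<forall>c x. blinfun_apply T (c *\<^sub>C x) = c *\<^sub>C blinfun_apply T x}"

lemma subspace_bounded_operators: "subspace bounded_operators"
  by (auto simp: subspace_def bounded_operators_def blinfun.bilinear_simps scaleC_add_right
      scaleR_scaleC scaleC_scaleC mult.commute
      intro: scaleC_add_right[where x = 0 and y = 0, simplified])

definition unitary :: "('a::complex_inner \<Rightarrow>\<^sub>L 'a) \<Rightarrow> bool"
  where "unitary U \<longleftrightarrow> U \<in> bounded_operators \<and> surj (blinfun_apply U) \<and>
    (\<forall>x y. cinner (blinfun_apply U x) (blinfun_apply U y) = cinner x y)"


definition orth_proj :: "'a::complex_inner set \<Rightarrow> 'a \<Rightarrow> 'a"
  where "orth_proj S x = (THE p. p \<in> S \<and> (\<forall>s\<in>S. cinner (x - p) s = 0))"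

definition proj_P :: "'a::complex_inner \<Rightarrow> 'a \<Rightarrow> 'a"
  where "proj_P a = orth_proj (range (\<lambda>c. c *\<^sub>C a))"

definition proj_Q :: "'a::complex_inner \<Rightarrow> 'a \<Rightarrow> 'a"
  where "proj_Q a z = z - proj_P a z"

definition alpha :: "'a::complex_inner \<Rightarrow> real"
  where "alpha a = sqrt (1 - (norm a)\<^sup>2)"

lemma proj_P_eq: "proj_P a z = (cinner z a / cinner a a) *\<^sub>C a"
  unfolding proj_P_def orth_proj_def
proof (rule the_equality)
  let ?p = "(cinner z a / cinner a a) *\<^sub>C a"
  have "cinner (z - ?p) a = 0"
  proof (cases "a = 0")
    case True
    then show ?thesis
      using cinner_scaleC_right[of "z - ?p" 0 a] by (simp add: scaleC_zero_left)
  qed (simp add: cinner_diff_left cinner_scaleC_left cinner_eq_zero_iff)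
  then show "?p \<in> range (\<lambda>c. c *\<^sub>C a) \<and> (\<forall>s\<in>range (\<lambda>c. c *\<^sub>C a). cinner (z - ?p) s = 0)"
    by (auto simp: cinner_scaleC_right)
next
  fix p
  assume p: "p \<in> range (\<lambda>c. c *\<^sub>C a) \<and> (\<forall>s\<in>range (\<lambda>c. c *\<^sub>C a). cinner (z - p) s = 0)"
  then obtain c where c: "p = c *\<^sub>C a" by blast
  from p have "cinner (z - p) (1 *\<^sub>C a) = 0" by blast
  then have "cinner z a = c * cinner a a"
    by (simp add: c scaleC_one cinner_diff_left cinner_scaleC_left)
  moreover have "a = 0" if "cinner a a = 0"
    using that by (simp add: cinner_eq_zero_iff)
  moreover have "b *\<^sub>C (0::'a) = 0" for b
    using scaleC_add_right[of b 0 0] by simp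
  ultimately show "p = (cinner z a / cinner a a) *\<^sub>C a"
    by (cases "cinner a a = 0") (auto simp: c)
qed

lemma norm_proj_P_le: "norm (proj_P a z) \<le> norm z"
proof -
  let ?p = "proj_P a z"
  define k where "k = cinner z a / cinner a a"
  have p: "?p = k *\<^sub>C a" by (simp add: proj_P_eq k_def)
  have orth: "cinner (z - ?p) ?p = 0"
  proof (cases "a = 0")
    case True
    then have "?p = 0"
      using scaleC_add_right[of k 0 0] unfolding p by simp
    then show ?thesis
      using cinner_scaleC_right[of z 0 0] by (simp add: scaleC_zero_left)
  qed (simp add: p k_def cinner_diff_left cinner_scaleC_left cinner_scaleC_right
      cinner_eq_zero_iff)
  have "cinner z z = cinner ((z - ?p) + ?p) ((z - ?p) + ?p)" by simp
  also have "\<dots> = cinner (z - ?p) (z - ?p) + cinner ?p ?p"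
    using orth cinner_commute[of ?p "z - ?p"]
    by (simp only: cinner_add_left cinner_add_right) simp
  finally have "complex_of_real ((norm z)\<^sup>2)
      = complex_of_real ((norm (z - ?p))\<^sup>2 + (norm ?p)\<^sup>2)"
    by (simp add: cinner_self)
  then have "(norm z)\<^sup>2 = (norm (z - ?p))\<^sup>2 + (norm ?p)\<^sup>2"
    by (simp only: of_real_eq_iff)
  then show ?thesis
    by (intro power2_le_imp_le[of "norm ?p"]) auto
qed

lemma bounded_linear_proj_P: "bounded_linear (proj_P a)"
proof (rule bounded_linear_intro[where K = 1])
  fix x y :: 'a and r :: real
  show "proj_P a (x + y) = proj_P a x + proj_P a y"
    by (simp add: proj_P_eq cinner_add_left add_divide_distrib scaleC_add_left)
  show "proj_P a (r *\<^sub>R x) = r *\<^sub>R proj_P a x"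
    by (simp add: proj_P_eq scaleR_scaleC cinner_scaleC_left scaleC_scaleC)
  show "norm (proj_P a x) \<le> norm x * 1"
    using norm_proj_P_le by simp
qed

lemma bounded_linear_cinner_left: "bounded_linear (\<lambda>x. cinner x (a::'a::complex_inner))"
proof (rule bounded_linear_intro[where K = "norm a"])
  fix x y :: 'a and r :: real
  show "cinner (x + y) a = cinner x a + cinner y a"
    by (rule cinner_add_left)
  show "cinner (r *\<^sub>R x) a = r *\<^sub>R cinner x a"
    by (simp only: scaleR_scaleC[where 'a = 'a] cinner_scaleC_left scaleR_conv_of_real)
  show "norm (cinner x a) \<le> norm x * norm a"
  proof (cases "a = 0")
    case True
    then show ?thesis
      using cinner_scaleC_right[of x 0 a] by (simp add: scaleC_zero_left)
  next
    case False
    then show ?thesis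
      using norm_proj_P_le[of a x]
      by (simp add: proj_P_eq norm_scaleC norm_divide cinner_self norm_mult power2_eq_square
          field_simps)
  qed
qed

lemma bounded_linear_scaleC_left: "bounded_linear (\<lambda>c. c *\<^sub>C (b::'a::complex_inner))"
  by (rule bounded_linear_intro[where K = "norm b"])
    (simp_all add: scaleC_add_left norm_scaleC scaleR_scaleC scaleC_scaleC scaleC_complex_def)


text \<open>The operator \<open>M\<^sub>\<phi>\<close> for \<open>\<phi> = \<phi>\<^bsub>a,U\<^esub>\<close>.\<close>

lift_definition M_op :: "'a::complex_inner \<Rightarrow> ('a \<Rightarrow>\<^sub>L 'a) \<Rightarrow> ('a \<times> complex) \<Rightarrow>\<^sub>L ('a \<times> complex)"
  is "\<lambda>a U (x, l). (U (proj_P a x + alpha a *\<^sub>R proj_Q a x) - l *\<^sub>C U a, - cinner x a + l)"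
  unfolding split_def proj_Q_def
  by (intro bounded_linear_Pair bounded_linear_sub bounded_linear_add bounded_linear_minus
      bounded_linear_const_scaleR bounded_linear_fst bounded_linear_snd
      bounded_linear_compose[OF bounded_linear_proj_P bounded_linear_fst]
      bounded_linear_compose[OF bounded_linear_cinner_left bounded_linear_fst]
      bounded_linear_compose[OF bounded_linear_scaleC_left bounded_linear_snd]
    | rule bounded_linear_compose, assumption)+


text \<open>
  Smooth points of the normed space \<open>X\<close>, a linear subspace of an ambient normed space with the
  inherited norm.
\<close>

definition smooth_point :: "'v::real_normed_vector set \<Rightarrow> 'v \<Rightarrow> bool"
  where "smooth_point X x \<longleftrightarrow> x \<in> X \<and> x \<noteq> 0 \<and>
    (\<forall>y\<in>X. \<exists>L::real. ((\<lambda>t::real. (norm (x + t *\<^sub>R y) - norm x) / t) \<longlongrightarrow> L) (at 0))"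

end

theory Submission
  imports Defs
begin

text \<open>
  A bounded complex-linear operator is a smooth point as soon as it stretches one complex line
  strictly more than everything orthogonal to that line. Suppose that \<open>v\<close> is a unit vector with
  \<open>\<parallel>T v\<parallel> = \<sigma>\<close>, and that \<open>T\<close> maps the orthogonal complement of \<open>v\<close> into that of \<open>T v\<close> with norm at
  most \<open>\<beta> < \<sigma>\<close>. For a perturbation \<open>Y\<close>, evaluation at \<open>v\<close> gives the lower bound
  \<open>\<parallel>T + t Y\<parallel> \<ge> \<sigma> + t m / \<sigma>\<close> with \<open>m = Re \<langle>Y v, T v\<rangle>\<close>. Conversely, a vector \<open>u\<close> whose component \<open>z\<close>
  orthogonal to \<open>v\<close> is nonzero gains at most a multiple of \<open>\<bar>t\<bar> \<parallel>z\<parallel> \<parallel>u\<parallel>\<close> beyond the linear term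
  in \<open>\<parallel>(T + t Y) u\<parallel>\<^sup>2\<close>, but loses \<open>(\<sigma>\<^sup>2 - \<beta>\<^sup>2) \<parallel>z\<parallel>\<^sup>2\<close>; so the net gain is \<open>O(t\<^sup>2)\<close>, uniformly in
  unit vectors \<open>u\<close>. Hence the norm is differentiable along \<open>Y\<close> with derivative \<open>m / \<sigma>\<close>
  (lemma \<open>smooth_point_of_spectral_gap\<close>).

  For \<open>M\<^sub>\<phi>\<close> put \<open>r = \<parallel>a\<parallel> > 0\<close>. Up to the isometry \<open>U \<oplus> 1\<close> the operator is self-adjoint; on the
  span of \<open>(a, 0)\<close> and \<open>(0, 1)\<close> it has the eigenvalues \<open>1 + r\<close> and \<open>1 - r\<close>, and on the orthogonal
  complement of that span it is the scalar \<open>\<alpha>(a)\<close>, where \<open>\<alpha>(a)\<^sup>2 = (1 - r) (1 + r)\<close>. An eigenvector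
  for \<open>1 + r\<close> is \<open>(a, - r)\<close>, and on its orthogonal complement the norm is at most
  \<open>\<alpha>(a) < 1 + r\<close>. At \<open>a = 0\<close> both numbers are \<open>1\<close> and the
  gap closes; this is where the hypothesis that \<open>\<phi>\<close> is not a rotation enters.
\<close>

section \<open>Complex inner product spaces\<close>

lemma cinner_zero_right [simp]: "cinner (x::'a::complex_inner) 0 = 0"
  using cinner_add_right[of x 0 0] by simp

lemma cinner_scaleR_left: "cinner (r *\<^sub>R x) y = of_real r * cinner (x::'a::complex_inner) y"
  by (simp add: scaleR_scaleC cinner_scaleC_left)

lemma cinner_scaleR_right: "cinner x (r *\<^sub>R y) = of_real r * cinner (x::'a::complex_inner) y"
  by (simp add: scaleR_scaleC cinner_scaleC_right)

lemma Re_cinner_commute: "Re (cinner x y) = Re (cinner y (x::'a::complex_inner))"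
  by (subst cinner_commute) simp

lemma norm_cinner_le: "cmod (cinner x y) \<le> norm x * norm (y::'a::complex_inner)"
proof (cases "y = 0")
  case False
  then show ?thesis
    using norm_proj_P_le[of y x]
    by (simp add: proj_P_eq norm_scaleC norm_divide cinner_self norm_mult power2_eq_square
        field_simps)
qed simp

lemma norm_add_power2:
  "(norm (x + y))\<^sup>2 = (norm x)\<^sup>2 + 2 * Re (cinner x y) + (norm (y::'a::complex_inner))\<^sup>2"
proof -
  have sq: "(norm u)\<^sup>2 = Re (cinner u u)" for u :: 'a
    by (simp add: cinner_self)
  show ?thesis
    unfolding sq by (simp add: cinner_add_left cinner_add_right Re_cinner_commute[of y x])
qed

section \<open>Smoothness from a gap below the norm\<close>

text \<open>
  The loss \<open>(\<sigma>\<^sup>2 - \<beta>\<^sup>2) \<parallel>z\<parallel>\<^sup>2\<close> caused by the component \<open>z\<close> orthogonal to \<open>v\<close> absorbs every term of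
  first order in \<open>t\<close> that involves \<open>z\<close>, at the price of a term of order \<open>t\<^sup>2\<close>.
\<close>

lemma norm_perturbed_power2_le:
  fixes T Y :: "'a::complex_inner \<Rightarrow>\<^sub>L 'a"
  assumes T: "T \<in> bounded_operators" and Y: "Y \<in> bounded_operators"
    and v: "norm v = 1"
    and orth: "\<And>z. cinner z v = 0 \<Longrightarrow> cinner (T z) (T v) = 0"
    and bound: "\<And>z. cinner z v = 0 \<Longrightarrow> norm (T z) \<le> \<beta> * norm z"
    and gap: "0 \<le> \<beta>" "\<beta> < norm (T v)"
  defines "C \<equiv> (3 * norm (T v) * norm Y)\<^sup>2 / ((norm (T v))\<^sup>2 - \<beta>\<^sup>2) + (norm Y)\<^sup>2"
  shows "(norm ((T + t *\<^sub>R Y) u))\<^sup>2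
    \<le> ((norm (T v))\<^sup>2 + 2 * t * Re (cinner (T v) (Y v)) + C * t\<^sup>2) * (norm u)\<^sup>2"
proof -
  define \<sigma> where "\<sigma> = norm (T v)"
  define m where "m = Re (cinner (T v) (Y v))"
  define K where "K = 3 * \<sigma> * norm Y"
  define \<delta> where "\<delta> = \<sigma>\<^sup>2 - \<beta>\<^sup>2"
  define c where "c = cinner u v"
  define z where "z = u - c *\<^sub>C v"
  have \<sigma>: "0 \<le> \<sigma>" "\<beta> \<le> \<sigma>" using gap by (simp_all add: \<sigma>_def)
  have \<delta>: "\<delta> > 0"
    using power_strict_mono[of \<beta> \<sigma> 2] gap by (simp add: \<delta>_def \<sigma>_def)
  have u: "u = c *\<^sub>C v + z" by (simp add: z_def)
  have zv: "cinner z v = 0"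
    by (simp add: z_def c_def cinner_diff_left cinner_scaleC_left cinner_self v)
  then have vz: "cinner v z = 0" by (subst cinner_commute) simp
  have Tzv: "cinner (T z) (T v) = 0" by (rule orth[OF zv])
  then have Tvz: "cinner (T v) (T z) = 0" by (subst cinner_commute) simp
  have Tz: "norm (T z) \<le> \<beta> * norm z" by (rule bound[OF zv])
  have Yle: "norm (Y x) \<le> norm Y * norm x" for x by (rule norm_blinfun)
  have nu: "(norm u)\<^sup>2 = (cmod c)\<^sup>2 + (norm z)\<^sup>2"
    unfolding u by (simp add: norm_add_power2 cinner_scaleC_left vz norm_scaleC v)
  then have cu: "cmod c \<le> norm u" and zu: "norm z \<le> norm u"
    by (auto intro: power2_le_imp_le)
  have Tu: "T u = c *\<^sub>C T v + T z" and Yu: "Y u = c *\<^sub>C Y v + Y z"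
    using T Y unfolding u by (simp_all add: blinfun.add_right bounded_operators_def)
  have "(norm (T u))\<^sup>2 = (cmod c)\<^sup>2 * \<sigma>\<^sup>2 + (norm (T z))\<^sup>2"
    unfolding Tu
    by (simp add: norm_add_power2 cinner_scaleC_left Tvz norm_scaleC power_mult_distrib \<sigma>_def)
  moreover have "(norm (T z))\<^sup>2 \<le> \<beta>\<^sup>2 * (norm z)\<^sup>2"
    using power_mono[OF Tz, of 2] by (simp add: power_mult_distrib)
  ultimately have Tu2: "(norm (T u))\<^sup>2 \<le> \<sigma>\<^sup>2 * (norm u)\<^sup>2 - \<delta> * (norm z)\<^sup>2"
    by (simp add: nu \<delta>_def algebra_simps)
  have cross: "\<bar>Re (cinner (T u) (Y u)) - m * (norm u)\<^sup>2\<bar> \<le> K * norm z * norm u"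
  proof -
    have split: "cinner (T u) (Y u)
        = (cmod c)\<^sup>2 *\<^sub>R cinner (T v) (Y v) + c * cinner (T v) (Y z) + cinner (T z) (Y u)"
    proof -
      have "cinner (T u) (Y u) = c * cinner (T v) (Y u) + cinner (T z) (Y u)"
        unfolding Tu by (simp add: cinner_add_left cinner_scaleC_left)
      also have "cinner (T v) (Y u) = cnj c * cinner (T v) (Y v) + cinner (T v) (Y z)"
        unfolding Yu by (simp add: cinner_add_right cinner_scaleC_right)
      finally show ?thesis
        by (simp only: scaleR_conv_of_real complex_norm_square) (simp add: algebra_simps)
    qed
    have "\<bar>Re (c * cinner (T v) (Y z))\<bar> \<le> norm u * (\<sigma> * (norm Y * norm z))"
    proof -
      have "\<bar>Re (c * cinner (T v) (Y z))\<bar> \<le> cmod c * cmod (cinner (T v) (Y z))"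
        using abs_Re_le_cmod[of "c * cinner (T v) (Y z)"] by (simp only: norm_mult)
      also have "cmod (cinner (T v) (Y z)) \<le> \<sigma> * (norm Y * norm z)"
        using norm_cinner_le[of "T v" "Y z"] mult_left_mono[OF Yle[of z] \<sigma>(1)]
        by (simp add: \<sigma>_def)
      finally show ?thesis
        using cu \<sigma> by (meson mult_left_mono mult_right_mono norm_ge_zero mult_nonneg_nonneg
            order_trans)
    qed
    moreover have "\<bar>Re (cinner (T z) (Y u))\<bar> \<le> (\<sigma> * norm z) * (norm Y * norm u)"
    proof -
      have "\<bar>Re (cinner (T z) (Y u))\<bar> \<le> norm (T z) * norm (Y u)"
        using abs_Re_le_cmod norm_cinner_le order_trans by blast
      also have "norm (T z) \<le> \<sigma> * norm z"
        using Tz mult_right_mono[OF \<sigma>(2), of "norm z"] by simp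
      finally show ?thesis
        using Yle[of u] \<sigma> by (meson mult_left_mono mult_right_mono norm_ge_zero
            mult_nonneg_nonneg order_trans)
    qed
    moreover have "\<bar>m * (norm z)\<^sup>2\<bar> \<le> (\<sigma> * norm Y) * (norm z * norm u)"
    proof -
      have "\<bar>m\<bar> \<le> \<sigma> * norm Y"
        using abs_Re_le_cmod[of "cinner (T v) (Y v)"] norm_cinner_le[of "T v" "Y v"]
          mult_left_mono[OF Yle[of v] \<sigma>(1)] by (simp add: m_def \<sigma>_def v)
      then show ?thesis
        unfolding abs_mult power2_eq_square
        using zu \<sigma> by (intro mult_mono) (auto intro: mult_left_mono)
    qed
    moreover have "Re (cinner (T u) (Y u)) - m * (norm u)\<^sup>2
        = Re (c * cinner (T v) (Y z)) + Re (cinner (T z) (Y u)) - m * (norm z)\<^sup>2"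
      unfolding split m_def nu
      by (simp add: algebra_simps)
    ultimately show ?thesis
      by (simp add: K_def algebra_simps)
  qed
  have "(norm ((T + t *\<^sub>R Y) u))\<^sup>2
      = (norm (T u))\<^sup>2 + 2 * (t * Re (cinner (T u) (Y u))) + t\<^sup>2 * (norm (Y u))\<^sup>2"
    by (simp add: blinfun.bilinear_simps norm_add_power2 cinner_scaleR_right power_mult_distrib)
  moreover have "t\<^sup>2 * (norm (Y u))\<^sup>2 \<le> t\<^sup>2 * ((norm Y)\<^sup>2 * (norm u)\<^sup>2)"
    using power_mono[OF Yle[of u], of 2] by (simp add: power_mult_distrib mult_left_mono)
  moreover have "t * Re (cinner (T u) (Y u)) \<le> t * m * (norm u)\<^sup>2 + \<bar>t\<bar> * K * norm z * norm u"
  proof -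
    have "t * (Re (cinner (T u) (Y u)) - m * (norm u)\<^sup>2)
        \<le> \<bar>t\<bar> * \<bar>Re (cinner (T u) (Y u)) - m * (norm u)\<^sup>2\<bar>"
      by (metis abs_ge_self abs_mult)
    also have "\<dots> \<le> \<bar>t\<bar> * (K * norm z * norm u)"
      by (rule mult_left_mono[OF cross]) simp
    finally show ?thesis by (simp add: algebra_simps)
  qed
  \<comment> \<open>Complete the square to trade the mixed term for the loss and a term in \<open>t\<^sup>2\<close>.\<close>
  moreover have "2 * (\<bar>t\<bar> * K * norm z * norm u)
      \<le> \<delta> * (norm z)\<^sup>2 + K\<^sup>2 / \<delta> * t\<^sup>2 * (norm u)\<^sup>2"
  proof -
    have "0 \<le> (\<delta> * norm z - K * \<bar>t\<bar> * norm u)\<^sup>2 / \<delta>" using \<delta> by simp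
    also have "\<dots> = \<delta> * (norm z)\<^sup>2 + K\<^sup>2 / \<delta> * t\<^sup>2 * (norm u)\<^sup>2 - 2 * (\<bar>t\<bar> * K * norm z * norm u)"
      using \<delta> by (simp add: power2_diff power_mult_distrib field_simps power2_eq_square)
    finally show ?thesis by simp
  qed
  moreover have "(\<sigma>\<^sup>2 + 2 * t * m + C * t\<^sup>2) * (norm u)\<^sup>2 = \<sigma>\<^sup>2 * (norm u)\<^sup>2
      + 2 * (t * m * (norm u)\<^sup>2) + K\<^sup>2 / \<delta> * t\<^sup>2 * (norm u)\<^sup>2 + t\<^sup>2 * ((norm Y)\<^sup>2 * (norm u)\<^sup>2)"
  proof -
    have "C = K\<^sup>2 / \<delta> + (norm Y)\<^sup>2"
      by (simp add: C_def K_def \<delta>_def \<sigma>_def)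
    then show ?thesis by (simp add: ring_distribs mult.commute mult.left_commute)
  qed
  ultimately show ?thesis
    using Tu2 unfolding \<sigma>_def[symmetric] m_def[symmetric] by linarith
qed

text \<open>
  The line of \<open>v\<close> is the only one on which the norm of \<open>T\<close> is attained, and the functional
  \<open>Y \<mapsto> Re \<langle>Y v, T v\<rangle> / \<parallel>T v\<parallel>\<close> that norms \<open>T\<close> is the derivative. The gap makes this
  robust: uniqueness of the maximizing line alone would leave room for almost-maximizing vectors far
  from \<open>v\<close>.
\<close>

lemma smooth_point_of_spectral_gap:
  fixes T :: "'a::complex_inner \<Rightarrow>\<^sub>L 'a"
  assumes T: "T \<in> bounded_operators"
    and v: "norm v = 1"
    and orth: "\<And>z. cinner z v = 0 \<Longrightarrow> cinner (T z) (T v) = 0"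
    and bound: "\<And>z. cinner z v = 0 \<Longrightarrow> norm (T z) \<le> \<beta> * norm z"
    and gap: "0 \<le> \<beta>" "\<beta> < norm (T v)"
  shows "smooth_point bounded_operators T"
proof -
  define \<sigma> where "\<sigma> = norm (T v)"
  have \<sigma>: "\<sigma> > 0" using gap unfolding \<sigma>_def by linarith
  \<comment> \<open>The norm agrees with its first-order expansion up to an error between \<open>0\<close> and \<open>D t\<^sup>2\<close>.\<close>
  have expansion: "\<exists>D. \<forall>t. \<sigma> + t * (m / \<sigma>) \<le> norm (T + t *\<^sub>R Y)
      \<and> norm (T + t *\<^sub>R Y) \<le> \<sigma> + t * (m / \<sigma>) + D * t\<^sup>2"
    if Y: "Y \<in> bounded_operators" and m: "m = Re (cinner (T v) (Y v))" for Y m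
  proof -
    obtain C where C: "\<And>t u. (norm ((T + t *\<^sub>R Y) u))\<^sup>2
        \<le> (\<sigma>\<^sup>2 + 2 * t * m + C * t\<^sup>2) * (norm u)\<^sup>2"
      using norm_perturbed_power2_le[OF T Y v orth bound gap] unfolding \<sigma>_def m by blast
    have "\<sigma> + t * (m / \<sigma>) \<le> norm (T + t *\<^sub>R Y)" for t
    proof -
      have "\<sigma>\<^sup>2 + t * m = Re (cinner (T v) ((T + t *\<^sub>R Y) v))"
        by (simp add: blinfun.bilinear_simps cinner_add_right cinner_scaleR_right cinner_self
            m \<sigma>_def)
      also have "\<dots> \<le> \<sigma> * norm ((T + t *\<^sub>R Y) v)"
        unfolding \<sigma>_def using complex_Re_le_cmod norm_cinner_le order_trans by blast
      also have "\<dots> \<le> \<sigma> * norm (T + t *\<^sub>R Y)"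
        using norm_blinfun[of "T + t *\<^sub>R Y" v] \<sigma> by (simp add: v)
      finally show ?thesis using \<sigma> by (simp add: field_simps power2_eq_square)
    qed
    moreover have "norm (T + t *\<^sub>R Y) \<le> \<sigma> + t * (m / \<sigma>) + C / (2 * \<sigma>) * t\<^sup>2" for t
    proof -
      define X where "X = \<sigma>\<^sup>2 + 2 * t * m + C * t\<^sup>2"
      define b where "b = \<sigma> + t * (m / \<sigma>) + C / (2 * \<sigma>) * t\<^sup>2"
      \<comment> \<open>\<open>b\<close> is the tangent of the square root at \<open>\<sigma>\<^sup>2\<close>, taken at \<open>X\<close>, so it lies above \<open>sqrt X\<close>.\<close>
      have b: "b = (X + \<sigma>\<^sup>2) / (2 * \<sigma>)"
        using \<sigma> by (simp add: b_def X_def field_simps power2_eq_square)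
      have "X \<ge> 0"
        using order_trans[OF zero_le_power2 C[of t v]] by (simp add: X_def v)
      then have b0: "b \<ge> 0" using \<sigma> by (simp add: b)
      have "b\<^sup>2 - X = ((X - \<sigma>\<^sup>2) / (2 * \<sigma>))\<^sup>2"
        using \<sigma> unfolding b by (simp add: field_simps power2_eq_square)
      then have Xb: "X \<le> b\<^sup>2" by (metis diff_ge_0_iff_ge zero_le_power2)
      have "norm ((T + t *\<^sub>R Y) u) \<le> b * norm u" for u
      proof (rule power2_le_imp_le)
        show "(norm ((T + t *\<^sub>R Y) u))\<^sup>2 \<le> (b * norm u)\<^sup>2"
          using C[of t u] mult_right_mono[OF Xb, of "(norm u)\<^sup>2"]
          by (simp add: X_def power_mult_distrib)
      qed (simp add: b0)
      then show ?thesis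
        unfolding b_def[symmetric] by (rule norm_blinfun_bound[OF b0])
    qed
    ultimately show ?thesis by blast
  qed
  have normT: "norm T = \<sigma>"
  proof -
    obtain D where "\<And>t. \<sigma> + t * (Re (cinner (T v) (T v)) / \<sigma>) \<le> norm (T + t *\<^sub>R T)
        \<and> norm (T + t *\<^sub>R T) \<le> \<sigma> + t * (Re (cinner (T v) (T v)) / \<sigma>) + D * t\<^sup>2"
      using expansion[OF T refl] by blast
    from this[of 0] show ?thesis by simp
  qed
  have "\<exists>L. ((\<lambda>t. (norm (T + t *\<^sub>R Y) - norm T) / t) \<longlongrightarrow> L) (at 0)"
    if Y: "Y \<in> bounded_operators" for Y
  proof -
    define L where "L = Re (cinner (T v) (Y v)) / \<sigma>"
    obtain D where D: "\<And>t. \<sigma> + t * L \<le> norm (T + t *\<^sub>R Y)"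
        "\<And>t. norm (T + t *\<^sub>R Y) \<le> \<sigma> + t * L + D * t\<^sup>2"
      using expansion[OF Y refl] unfolding L_def by blast
    have le: "norm ((norm (T + t *\<^sub>R Y) - norm T) / t - L) \<le> D * \<bar>t\<bar>" if "t \<noteq> 0" for t
    proof -
      have "(norm (T + t *\<^sub>R Y) - norm T) / t - L = (norm (T + t *\<^sub>R Y) - \<sigma> - t * L) / t"
        using that by (simp add: normT field_simps)
      moreover have "\<bar>norm (T + t *\<^sub>R Y) - \<sigma> - t * L\<bar> \<le> D * \<bar>t\<bar> * \<bar>t\<bar>"
        using D[of t] by (simp add: power2_eq_square)
      ultimately show ?thesis
        using that by (simp add: divide_le_eq)
    qed
    have "((\<lambda>t. D * \<bar>t\<bar>) \<longlongrightarrow> 0) (at (0::real))"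
      by (rule tendsto_eq_intros | simp)+
    then have "((\<lambda>t. (norm (T + t *\<^sub>R Y) - norm T) / t - L) \<longlongrightarrow> 0) (at 0)"
      by (rule Lim_null_comparison[rotated]) (simp add: eventually_at_filter le del: real_norm_def)
    then show ?thesis unfolding Lim_null[symmetric] by blast
  qed
  moreover have "T \<noteq> 0" using normT \<sigma> by auto
  ultimately show ?thesis using T by (simp add: smooth_point_def)
qed

section \<open>The operators of the ball automorphisms\<close>

lemma cinner_proj_Q: "cinner (proj_Q a x) (a::'a::complex_inner) = 0"
  by (cases "a = 0")
    (simp_all add: proj_Q_def proj_P_eq cinner_diff_left cinner_scaleC_left cinner_eq_zero_iff)

lemma proj_P_self [simp]: "proj_P a (a::'a::complex_inner) = a"
proof (cases "a = 0")
  case True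
  then show ?thesis
    using bounded_linear.linear[OF bounded_linear_proj_P[of a]] by (simp add: linear_0)
qed (simp add: proj_P_eq cinner_eq_zero_iff scaleC_one)

lemma unitary_cinner: "unitary U \<Longrightarrow> cinner (U x) (U y) = cinner x y"
  by (simp add: unitary_def)

lemma unitary_scaleC: "unitary U \<Longrightarrow> U (c *\<^sub>C x) = c *\<^sub>C U x"
  by (simp add: unitary_def bounded_operators_def)

lemma unitary_norm: "unitary U \<Longrightarrow> norm (U x) = norm x"
  by (simp add: norm_eq_sqrt_cinner unitary_cinner)

lemma scaleC_diff_right: "c *\<^sub>C (x - y) = c *\<^sub>C x - c *\<^sub>C (y::'a::complex_inner)"
  using scaleC_add_right[of c "x - y" y] by (simp add: algebra_simps)

lemma scaleC_scaleR: "c *\<^sub>C (r *\<^sub>R x) = r *\<^sub>R (c *\<^sub>C (x::'a::complex_inner))"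
  by (simp add: scaleR_scaleC scaleC_scaleC mult.commute)

lemma M_op_bounded_operators:
  assumes "unitary U"
  shows "M_op a U \<in> bounded_operators"
proof -
  have P: "proj_P a (c *\<^sub>C x) = c *\<^sub>C proj_P a x" for c x
    by (simp add: proj_P_eq cinner_scaleC_left scaleC_scaleC)
  then have Q: "proj_Q a (c *\<^sub>C x) = c *\<^sub>C proj_Q a x" for c x
    by (simp add: proj_Q_def scaleC_diff_right)
  have "M_op a U (c *\<^sub>C (x, l)) = c *\<^sub>C M_op a U (x, l)" for c x l
    by (simp add: M_op.rep_eq scaleC_prod_def P Q blinfun.bilinear_simps
        unitary_scaleC[OF assms] scaleC_diff_right scaleC_add_right scaleC_scaleC scaleC_scaleR
        scaleC_complex_def cinner_scaleC_left algebra_simps)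
  then show ?thesis by (auto simp: bounded_operators_def)
qed

lemma M_op_dominant_vector:
  fixes a :: "'a::complex_inner"
  shows "M_op a U (a, - of_real (norm a)) = (1 + norm a) *\<^sub>R (U a, - of_real (norm a))"
  by (simp add: M_op.rep_eq proj_Q_def cinner_self scaleC_minus_left scaleR_scaleC[symmetric]
      scaleR_conv_of_real power2_eq_square algebra_simps)

text \<open>
  Orthogonality to \<open>(a, - r)\<close> says \<open>\<langle>x, a\<rangle> = r l\<close>, so the projection of \<open>x\<close> to the line of \<open>a\<close> is
  \<open>(l / r) a\<close>. On that part of \<open>(x, l)\<close> the operator is \<open>1 - r\<close> followed by the isometry.
\<close>

lemma M_op_orthogonal:
  fixes a :: "'a::complex_inner"
  assumes a: "a \<noteq> 0" and U: "unitary U"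
    and orth: "cinner (x, l) (a, - of_real (norm a)) = 0"
  shows "x = (l / of_real (norm a)) *\<^sub>C a + proj_Q a x"
    and "M_op a U (x, l) = (U (((1 - of_real (norm a)) * l / of_real (norm a)) *\<^sub>C a + alpha a *\<^sub>R proj_Q a x),
      (1 - of_real (norm a)) * l)"
proof -
  have xa: "cinner x a = of_real (norm a) * l"
    using orth by (simp add: cinner_prod_def cinner_complex_def)
  have P: "proj_P a x = (l / of_real (norm a)) *\<^sub>C a"
    using a by (simp add: proj_P_eq xa cinner_self power2_eq_square)
  then show "x = (l / of_real (norm a)) *\<^sub>C a + proj_Q a x"
    by (simp add: proj_Q_def)
  have coeff: "(1 - of_real (norm a)) * l / of_real (norm a) = l / of_real (norm a) + (- l)"
    using a by (simp add: field_simps)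
  have Ua: "U ((k + - l) *\<^sub>C a) = k *\<^sub>C U a - l *\<^sub>C U a" for k
    using scaleC_add_left[of k "- l" "U a"]
    by (simp add: scaleC_minus_left unitary_scaleC[OF U])
  show "M_op a U (x, l) = (U (((1 - of_real (norm a)) * l / of_real (norm a)) *\<^sub>C a + alpha a *\<^sub>R proj_Q a x),
      (1 - of_real (norm a)) * l)"
    unfolding coeff
    by (simp only: M_op.rep_eq prod.case xa P blinfun.add_right Ua)
      (simp add: unitary_scaleC[OF U] algebra_simps)
qed

text \<open>
  The two eigenvalues below \<open>1 + r\<close> satisfy \<open>1 - r \<le> \<alpha>(a)\<close> because
  \<open>(1 - r)\<^sup>2 \<le> (1 - r) (1 + r)\<close>.
\<close>

lemma norm_M_op_orthogonal_le:
  fixes a :: "'a::complex_inner"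
  assumes a: "a \<noteq> 0" "norm a < 1" and U: "unitary U"
    and orth: "cinner (x, l) (a, - of_real (norm a)) = 0"
  shows "norm (M_op a U (x, l)) \<le> alpha a * norm (x, l)"
proof -
  define r where "r = norm a"
  define q where "q = proj_Q a x"
  have r: "0 < r" "r < 1" using a by (simp_all add: r_def)
  have al: "0 \<le> alpha a" "(alpha a)\<^sup>2 = 1 - r\<^sup>2"
    using r by (simp_all add: alpha_def r_def power_le_one)
  have qa: "cinner a q = 0"
    using cinner_proj_Q[of a x] by (subst cinner_commute) (simp add: q_def)
  have pyth: "(norm (k *\<^sub>C a + s *\<^sub>R q))\<^sup>2 = (cmod k * r)\<^sup>2 + s\<^sup>2 * (norm q)\<^sup>2" for k s
    by (simp add: norm_add_power2 cinner_scaleC_left cinner_scaleR_right qa norm_scaleC r_def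
        power_mult_distrib)
  have n1: "cmod (1 - of_real r) = 1 - r"
    using r by (metis abs_of_pos diff_gt_0_iff_gt norm_of_real of_real_1 of_real_diff)
  have z: "(norm (x, l))\<^sup>2 = 2 * (cmod l)\<^sup>2 + (norm q)\<^sup>2"
  proof -
    have "x = (l / of_real r) *\<^sub>C a + 1 *\<^sub>R q"
      using M_op_orthogonal(1)[OF a(1) U orth] by (simp add: q_def r_def)
    then have "(norm x)\<^sup>2 = (cmod l)\<^sup>2 + (norm q)\<^sup>2"
      using pyth[of "l / of_real r" 1] r by (simp add: norm_divide)
    then show ?thesis by (simp add: norm_prod_def)
  qed
  have "(norm (M_op a U (x, l)))\<^sup>2 = 2 * (1 - r)\<^sup>2 * (cmod l)\<^sup>2 + (alpha a)\<^sup>2 * (norm q)\<^sup>2"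
    using r pyth[of "(1 - of_real r) * l / of_real r" "alpha a"] unfolding M_op_orthogonal(2)[OF a(1) U orth]
    by (simp add: norm_prod_def unitary_norm[OF U] norm_mult norm_divide n1 power_mult_distrib
        flip: r_def q_def)
  also have "\<dots> \<le> 2 * (1 - r\<^sup>2) * (cmod l)\<^sup>2 + (alpha a)\<^sup>2 * (norm q)\<^sup>2"
  proof -
    have "(1 - r)\<^sup>2 \<le> 1 - r\<^sup>2"
      using r mult_left_mono[of "1 - r" "1 + r" "1 - r"] by (simp add: power2_eq_square algebra_simps)
    then show ?thesis
      using r by (intro add_mono mult_mono) (auto simp: power_le_one)
  qed
  also have "\<dots> = (alpha a * norm (x, l))\<^sup>2"
    unfolding power_mult_distrib z al(2) by (simp add: algebra_simps)
  finally show ?thesis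
    by (rule power2_le_imp_le) (simp add: al(1))
qed

theorem theorem1p1:
  fixes a :: "'a::chilbert_space" and U :: "'a \<Rightarrow>\<^sub>L 'a"
  assumes "a \<in> ball 0 1" and "a \<noteq> 0" and "unitary U"
  shows "smooth_point bounded_operators (M_op a U)"
proof -
  define r where "r = norm a"
  have r: "0 < r" "r < 1" using assms by (simp_all add: r_def)
  define h :: "'a \<times> complex" where "h = (a, - of_real r)"
  define s where "s = 1 / norm h"
  have h: "norm h > 0" using assms(2) by (simp add: h_def zero_prod_def)
  then have s: "s > 0" by (simp add: s_def)
  define v where "v = s *\<^sub>R h"
  have v: "norm v = 1" using h by (simp add: v_def s_def)
  have Tv: "M_op a U v = (s * (1 + r)) *\<^sub>R (U a, - of_real r)"
    unfolding v_def h_def r_def blinfun.scaleR_right M_op_dominant_vector by simp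
  have orth_h: "cinner z h = 0" if "cinner z v = 0" for z
    using that s by (simp add: v_def cinner_scaleR_right)
  show ?thesis
  proof (rule smooth_point_of_spectral_gap[where v = v and \<beta> = "alpha a"])
    show "M_op a U \<in> bounded_operators"
      by (rule M_op_bounded_operators[OF assms(3)])
    show "norm v = 1" by (rule v)
    show "cinner (M_op a U z) (M_op a U v) = 0" if "cinner z v = 0" for z
    proof (cases z)
      case (Pair x l)
      have "cinner (M_op a U (x, l)) (U a, - of_real r) = 0"
        using orth_h[OF that] r unfolding Pair h_def r_def
        by (simp add: M_op_orthogonal(2)[OF assms(2,3)] cinner_prod_def cinner_complex_def
            unitary_cinner[OF assms(3)] cinner_add_left cinner_scaleC_left cinner_scaleR_left
            cinner_proj_Q cinner_self power2_eq_square)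
      then show ?thesis unfolding Pair Tv cinner_scaleR_right by simp
    qed
    show "norm (M_op a U z) \<le> alpha a * norm z" if "cinner z v = 0" for z
      using norm_M_op_orthogonal_le[OF assms(2) _ assms(3), of "fst z" "snd z"] orth_h[OF that] r
      by (simp add: h_def r_def)
    show "0 \<le> alpha a"
      using r by (simp add: alpha_def r_def power_le_one)
    have "norm (M_op a U v) = 1 + r"
    proof -
      have "norm (U a, - complex_of_real r) = norm h"
        by (simp add: h_def norm_prod_def unitary_norm[OF assms(3)])
      then show ?thesis using r h s unfolding Tv norm_scaleR by (simp add: s_def)
    qed
    moreover have "alpha a \<le> 1" by (simp add: alpha_def)
    ultimately show "alpha a < norm (M_op a U v)" using r by simp
  qed
qed

end
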